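(* Let $\Omega\subset\mathbb{R}^2$ be a bounded simply connected domain with $C^{1,1}$ boundary and let $x_0\in\Omega$. Assume that $\Omega$ is invariant under the rotation of angle $\theta\in(0,2\pi)$ around $x_0$. Then $x_0$ is a stationary point, i.e. $\nabla\widetilde\gamma_\Omega(x_0)=0$. If moreover $\theta\neq\pi$, then $T'''(x_0)=0$ for any biholomorphism $T$ from $\Omega$ onto the unit disk with $T(x_0)=0$.
   Context: $\mathbb{R}^2$ is identified with $\mathbb{C}$ and $T'''$ is the third complex derivative of $T$. The Green's function $G_\Omega$ of $\Omega$ solves $\Delta_xG_\Omega(x,y)=\delta(x-y)$ and vanishes on $\partial\Omega$; $\gamma_\Omega(x,y)=G_\Omega(x,y)-\frac1{2\pi}\ln|x-y|$ extends to a smooth function on $\Omega\times\Omega$, and the Robin function is $\widetilde\gamma_\Omega(x)=\gamma_\Omega(x,x)$. A stationary point is a critical point of $\widetilde\gamma_\Omega$. *)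

theory Defs
  imports "HOL-Complex_Analysis.Complex_Analysis"
begin

primrec Ck_on :: "nat \<Rightarrow> ('a::euclidean_space \<Rightarrow> real) \<Rightarrow> 'a set \<Rightarrow> bool" where
  "Ck_on 0 f S \<longleftrightarrow> continuous_on S f"
| "Ck_on (Suc k) f S \<longleftrightarrow> (\<forall>x\<in>S. f differentiable (at x)) \<and>
     (\<forall>b\<in>Basis. Ck_on k (\<lambda>x. frechet_derivative f (at x) b) S)"

(* Meant for open S: derivatives are taken at points of S in the whole space. *)
definition smooth_on :: "'a::euclidean_space set \<Rightarrow> ('a \<Rightarrow> real) \<Rightarrow> bool" where
  "smooth_on S f \<longleftrightarrow> (\<forall>k. Ck_on k f S)"

definition laplacian :: "('a::euclidean_space \<Rightarrow> real) \<Rightarrow> 'a \<Rightarrow> real" where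
  "laplacian f x =
     (\<Sum>b\<in>Basis. frechet_derivative (\<lambda>z. frechet_derivative f (at z) b) (at x) b)"

definition test_function :: "'a::euclidean_space set \<Rightarrow> ('a \<Rightarrow> real) \<Rightarrow> bool" where
  "test_function \<Omega> \<phi> \<longleftrightarrow> smooth_on UNIV \<phi> \<and>
     compact (closure {x. \<phi> x \<noteq> 0}) \<and> closure {x. \<phi> x \<noteq> 0} \<subseteq> \<Omega>"

(* The equation "Laplacian of u = delta_y on \<Omega>" in the sense of distributions, for a locally
   integrable u. *)
definition laplacian_eq_delta :: "'a::euclidean_space set \<Rightarrow> ('a \<Rightarrow> real) \<Rightarrow> 'a \<Rightarrow> bool" where
  "laplacian_eq_delta \<Omega> u y \<longleftrightarrow>
     (\<forall>K. compact K \<and> K \<subseteq> \<Omega> \<longrightarrow> u absolutely_integrable_on K) \<and>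
     (\<forall>\<phi>. test_function \<Omega> \<phi> \<longrightarrow> (LINT x:\<Omega>|lebesgue. u x * laplacian \<phi> x) = \<phi> y)"

(* Sign convention: the Laplacian of G is +delta, so G is negative inside \<Omega>. Continuity up to
   the boundary is what gives the boundary condition its meaning. *)
definition green_function :: "complex set \<Rightarrow> (complex \<Rightarrow> complex \<Rightarrow> real) \<Rightarrow> bool" where
  "green_function \<Omega> G \<longleftrightarrow> (\<forall>y\<in>\<Omega>.
     laplacian_eq_delta \<Omega> (\<lambda>x. G x y) y \<and>
     continuous_on (closure \<Omega> - {y}) (\<lambda>x. G x y) \<and>
     (\<forall>x\<in>frontier \<Omega>. G x y = 0))"

(* \<gamma> is the smooth extension to \<Omega> \<times> \<Omega> of G(x,y) - ln |x - y| / (2 pi); being continuous, it is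
   determined on \<Omega> \<times> \<Omega> by its values off the diagonal. *)
definition regular_part ::
  "complex set \<Rightarrow> (complex \<Rightarrow> complex \<Rightarrow> real) \<Rightarrow> (complex \<times> complex \<Rightarrow> real) \<Rightarrow> bool" where
  "regular_part \<Omega> G \<gamma> \<longleftrightarrow> smooth_on (\<Omega> \<times> \<Omega>) \<gamma> \<and>
     (\<forall>x\<in>\<Omega>. \<forall>y\<in>\<Omega>. x \<noteq> y \<longrightarrow> \<gamma> (x, y) = G x y - 1 / (2 * pi) * ln (cmod (x - y)))"

definition robin :: "(complex \<times> complex \<Rightarrow> real) \<Rightarrow> complex \<Rightarrow> real" where
  "robin \<gamma> x = \<gamma> (x, x)"

(* Near each boundary point p, in orthonormal coordinates (s, t) centred at p (the t-axis pointing
   along \<i> * u), \<Omega> is the region strictly above the graph of a C^{1,1} function g. *)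
definition C11_boundary :: "complex set \<Rightarrow> bool" where
  "C11_boundary \<Omega> \<longleftrightarrow> (\<forall>p\<in>frontier \<Omega>. \<exists>u r g g' L.
     cmod u = 1 \<and> r > 0 \<and>
     (\<forall>s\<in>{-r<..<r}. (g has_real_derivative g' s) (at s)) \<and>
     L-lipschitz_on {-r<..<r} g' \<and>
     (\<forall>s\<in>{-r<..<r}. \<forall>t\<in>{-r<..<r}. p + u * Complex s t \<in> \<Omega> \<longleftrightarrow> t > g s))"

definition rotation :: "complex \<Rightarrow> real \<Rightarrow> complex \<Rightarrow> complex" where
  "rotation c \<theta> z = c + cis \<theta> * (z - c)"

definition biholomorphism :: "(complex \<Rightarrow> complex) \<Rightarrow> complex set \<Rightarrow> complex set \<Rightarrow> bool" where
  "biholomorphism f S S' \<longleftrightarrow> bij_betw f S S' \<and> f holomorphic_on S \<and>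
     the_inv_into S f holomorphic_on S'"

end

theory Submission imports Defs begin

text \<open>
  Write \<open>R\<close> for the rotation. The Green's function of \<open>\<Omega>\<close> is determined by \<open>\<Omega>\<close>, so it is invariant under
  the symmetry \<open>R\<close>: \<open>\<gamma> (R x, R y) = \<gamma> (x, y)\<close> (\<open>regular_part_rotate\<close>). Hence the Robin function is
  invariant under \<open>R\<close>, and its gradient at the fixed point \<open>x0\<close> is fixed by a nontrivial rotation of the
  plane, so it vanishes (\<open>robin_stationary\<close>).

  Uniqueness needs that \<open>\<gamma> (\<cdot>, y)\<close> is harmonic. As \<open>\<gamma>\<close> is assumed smooth, no regularity theory is
  involved: the distributional equation is tested against bump functions concentrated near a point
  \<open>p \<noteq> y\<close>, and two integrations by parts show that the classical Laplacian of \<open>G (\<cdot>, y)\<close> vanishes at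
  \<open>p\<close> (\<open>trace_eq_0_of_laplacian_eq_delta\<close>). The logarithm is harmonic off \<open>y\<close>, so the Laplacian of
  \<open>\<gamma> (\<cdot>, y)\<close> is zero off \<open>y\<close>, and at \<open>y\<close> by continuity (\<open>regular_part_harmonic\<close>). Then
  \<open>\<gamma> (R x, R y) - \<gamma> (x, y)\<close> is harmonic in \<open>x\<close>; the logarithms cancel because \<open>R\<close> is an isometry, so it
  equals \<open>G (R x) (R y) - G x y\<close> off \<open>y\<close>, has boundary values zero, and is zero by the maximum
  principle.

  For the second claim, \<open>T \<circ> R \<circ> inv T\<close> is a holomorphic self-map of the disk which fixes 0 with derivative
  \<open>cis \<theta>\<close> there, so it is multiplication by \<open>cis \<theta>\<close> by the Schwarz lemma (\<open>biholomorphism_rotate\<close>).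
  The third derivative of \<open>T (R z) = cis \<theta> * T z\<close> at \<open>x0\<close> is \<open>cis (3 * \<theta>) * T''' = cis \<theta> * T'''\<close>, which
  forces \<open>T''' = 0\<close> unless \<open>2 * \<theta>\<close> is a multiple of \<open>2 * pi\<close>.
\<close>

section \<open>Integrals of derivatives\<close>

lemma integral_translate_lborel:
  fixes F :: "'a::euclidean_space \<Rightarrow> real"
  assumes "integrable lborel F"
  shows "integrable lborel (\<lambda>x. F (a + x))" "integral\<^sup>L lborel (\<lambda>x. F (a + x)) = integral\<^sup>L lborel F"
proof -
  have m: "(+) a \<in> lborel \<rightarrow>\<^sub>M borel" "F \<in> borel_measurable borel"
    using assms by (simp_all add: borel_measurable_integrable[of lborel F, simplified])
  show "integrable lborel (\<lambda>x. F (a + x))"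
    using integrable_distr[of "(+) a" lborel borel F] assms m by (simp add: lborel_distr_plus)
  show "integral\<^sup>L lborel (\<lambda>x. F (a + x)) = integral\<^sup>L lborel F"
    using integral_distr[OF m] by (simp add: lborel_distr_plus)
qed

lemma integrable_continuous_compact_support:
  fixes F :: "'a::euclidean_space \<Rightarrow> real"
  assumes "continuous_on UNIV F" "compact K" "\<And>x. x \<notin> K \<Longrightarrow> F x = 0"
  shows "integrable lborel F"
proof -
  have "integrable lborel (\<lambda>x. indicator K x *\<^sub>R F x)"
    using assms continuous_on_subset by (intro borel_integrable_compact) blast+
  also have "(\<lambda>x. indicator K x *\<^sub>R F x) = F"
    using assms(3) by (fastforce simp: indicator_def)
  finally show ?thesis .
qed

text \<open>
  Integration by parts in the form that avoids iterated integrals: by translation invariance the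
  difference quotients of \<open>F\<close> in direction \<open>e\<close> have integral zero, and they converge to the
  derivative, dominated by a constant on a fixed ball because of the mean value theorem.
\<close>
lemma integral_directional_derivative_eq_0:
  fixes F :: "'a::euclidean_space \<Rightarrow> real"
  assumes F: "\<And>x. (F has_derivative F' x) (at x)"
    and cont: "continuous_on UNIV (\<lambda>x. F' x e)"
    and K: "compact K" "\<And>x. x \<notin> K \<Longrightarrow> F x = 0"
  shows "integral\<^sup>L lborel (\<lambda>x. F' x e) = 0"
proof -
  have F'0: "F' x e = 0" if "x \<notin> K" for x
  proof -
    have "open (- K)" using K(1) compact_imp_closed by blast
    then have "((\<lambda>_. 0) has_derivative F' x) (at x)"
      using has_derivative_transform_within_open[OF F, of "- K"] that K(2) by auto
    then have "F' x = (\<lambda>_. 0)"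
      by (intro has_derivative_unique[of "\<lambda>_. 0" "F' x" x "\<lambda>_. 0"] has_derivative_const) auto
    then show ?thesis by simp
  qed
  have contF: "continuous_on UNIV F"
    by (intro continuous_at_imp_continuous_on ballI has_derivative_continuous[OF F])
  have intF: "integrable lborel F"
    by (rule integrable_continuous_compact_support[OF contF K])
  obtain B where B: "\<And>x. \<bar>F' x e\<bar> \<le> B"
  proof -
    have "bounded ((\<lambda>x. F' x e) ` K)"
      by (intro compact_imp_bounded compact_continuous_image K continuous_on_subset[OF cont]) simp
    then obtain b where "b > 0" "\<forall>x\<in>K. \<bar>F' x e\<bar> \<le> b" 
      unfolding bounded_pos by auto
    then have "\<bar>F' x e\<bar> \<le> b" for x using F'0[of x] by (cases "x \<in> K") auto
    then show ?thesis by (rule that)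
  qed
  obtain r where r: "K \<subseteq> cball 0 r" 
  proof -
    obtain r where "\<forall>x\<in>K. norm x \<le> r"
      using compact_imp_bounded[OF K(1)] unfolding bounded_iff by blast
    then show ?thesis by (intro that[of r]) auto
  qed
  define h where "h n = 1 / real (Suc n)" for n
  have h: "0 < h n" "h n \<le> 1" for n by (auto simp: h_def)
  define s where "s n x = (F (h n *\<^sub>R e + x) - F x) / h n" for n x
  have d: "((\<lambda>t. F (t *\<^sub>R e + x)) has_real_derivative F' (t *\<^sub>R e + x) e) (at t)" for t x
  proof -
    have "((\<lambda>t. F (t *\<^sub>R e + x)) has_derivative (\<lambda>k. F' (t *\<^sub>R e + x) (k *\<^sub>R e))) (at t)"
      by (rule has_derivative_compose[OF _ F, of "\<lambda>t. t *\<^sub>R e + x", simplified])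
         (auto intro!: derivative_eq_intros)
    moreover have "F' (t *\<^sub>R e + x) (k *\<^sub>R e) = F' (t *\<^sub>R e + x) e * k" for k
      using linear_cmul[OF has_derivative_linear[OF F]] by (simp add: mult.commute)
    ultimately show ?thesis by (simp add: has_field_derivative_def)
  qed
  have bound: "\<bar>s n x\<bar> \<le> B * indicator (cball 0 (r + norm e)) x" for n x
  proof (cases "x \<in> cball 0 (r + norm e)")
    case True
    obtain t where "F (h n *\<^sub>R e + x) - F x = h n * F' (t *\<^sub>R e + x) e"
      using MVT2[of 0 "h n" "\<lambda>t. F (t *\<^sub>R e + x)" "\<lambda>t. F' (t *\<^sub>R e + x) e", OF h(1) d] by auto
    then show ?thesis using B h(1)[of n] True by (simp add: s_def)
  next
    case False
    have "norm (h n *\<^sub>R e) \<le> norm e" using h[of n] by (simp add: mult_left_le_one_le)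
    then have "h n *\<^sub>R e + x \<notin> cball 0 r" "x \<notin> cball 0 r"
      using False norm_triangle_ineq4[of "h n *\<^sub>R e + x" "h n *\<^sub>R e"] norm_ge_zero[of e]
      by (auto simp del: norm_ge_zero)
    then have "F (h n *\<^sub>R e + x) = 0" "F x = 0" using r K(2) by blast+
    then show ?thesis using False by (simp add: s_def)
  qed
  have lim: "(\<lambda>n. s n x) \<longlonglongrightarrow> F' x e" for x
  proof -
    have "filterlim h (at 0) sequentially"
      unfolding h_def[abs_def] filterlim_at using LIMSEQ_Suc[OF lim_inverse_n] 
      by (auto simp: inverse_eq_divide)
    from filterlim_compose[OF d[of x 0, unfolded DERIV_def] this]
    show ?thesis by (simp add: s_def)
  qed
  have "integral\<^sup>L lborel (s n) = 0" for n
    using integral_translate_lborel[OF intF] intF by (simp add: s_def[abs_def])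
  moreover have "(\<lambda>n. integral\<^sup>L lborel (s n)) \<longlonglongrightarrow> integral\<^sup>L lborel (\<lambda>x. F' x e)"
  proof (rule integral_dominated_convergence)
    show "(\<lambda>x. F' x e) \<in> borel_measurable lborel"
      using borel_measurable_continuous_onI[OF cont] by simp
    show "s i \<in> borel_measurable lborel" for i
      unfolding s_def using borel_measurable_continuous_onI[OF contF] by measurable
    show "integrable lborel (\<lambda>x. B * indicator (cball 0 (r + norm e)) x)"
      using borel_integrable_compact[of "cball 0 (r + norm e)" "\<lambda>_. B"] by (simp add: mult.commute)
  qed (use lim bound in auto)
  ultimately show ?thesis by (simp add: LIMSEQ_const_iff)
qed

section \<open>The maximum principle\<close>

lemma second_derivative_nonpos_at_max:
  fixes f f' :: "real \<Rightarrow> real"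
  assumes d: "\<delta> > 0"
    and f: "\<And>t. \<bar>t\<bar> < \<delta> \<Longrightarrow> (f has_real_derivative f' t) (at t)"
    and f': "(f' has_real_derivative c) (at 0)"
    and max: "\<And>t. \<bar>t\<bar> < \<delta> \<Longrightarrow> f t \<le> f 0"
  shows "c \<le> 0"
proof (rule ccontr)
  assume "\<not> c \<le> 0"
  then obtain d' where d': "d' > 0" "\<And>h. 0 < h \<Longrightarrow> h < d' \<Longrightarrow> f' 0 < f' h"
    using DERIV_pos_inc_right[OF f'] by auto
  have f0: "f' 0 = 0"
    by (rule DERIV_local_max[OF f[of 0] d]) (use d max in auto)
  define h where "h = min d' \<delta> / 2"
  have h: "0 < h" "h < d'" "h < \<delta>" using d d' by (auto simp: h_def)
  obtain t where "0 < t" "t < h" "f h - f 0 = (h - 0) * f' t"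
    using MVT2[OF h(1), of f f'] f h by auto
  moreover have "f' t > 0" using d'(2)[of t] f0 h calculation by auto
  ultimately show False using max[of h] h by (smt (verit) mult_pos_pos)
qed

lemma GDERIV_along_line:
  fixes u :: "complex \<Rightarrow> real"
  assumes "GDERIV u (p + of_real t * w) :> g"
  shows "((\<lambda>t. u (p + of_real t * w)) has_real_derivative g \<bullet> w) (at t)"
proof -
  have "((\<lambda>t. p + of_real t * w) has_derivative (\<lambda>k. of_real k * w)) (at t)"
    by (auto intro!: derivative_eq_intros)
  from has_derivative_compose[OF this assms[unfolded gderiv_def]]
  have "((\<lambda>t. u (p + of_real t * w)) has_derivative (\<lambda>k. (of_real k * w) \<bullet> g)) (at t)" .
  moreover have "(of_real k * w) \<bullet> g = (g \<bullet> w) * k" for k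
    by (simp add: inner_complex_def algebra_simps)
  ultimately show ?thesis by (simp add: has_field_derivative_def)
qed

text \<open>
  Second derivatives are handled through the derivative \<open>H\<close> of the gradient field \<open>g\<close> of \<open>u\<close>; the trace
  of the real-linear map \<open>H\<close> is then the Laplacian of \<open>u\<close>.
\<close>
definition trace2 :: "(complex \<Rightarrow> complex) \<Rightarrow> real" where
  "trace2 H = H 1 \<bullet> 1 + H \<i> \<bullet> \<i>"

lemma trace_nonpos_at_max:
  assumes U: "open U" "p \<in> U"
    and u: "\<And>z. z \<in> U \<Longrightarrow> GDERIV u z :> g z" and g: "(g has_derivative H) (at p)"
    and max: "\<And>z. z \<in> U \<Longrightarrow> u z \<le> u p"
  shows "trace2 H \<le> 0"
proof -
  obtain \<delta> where \<delta>: "\<delta> > 0" "ball p \<delta> \<subseteq> U" using U open_contains_ball by blast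
  have *: "H w \<bullet> w \<le> 0" if "norm w = 1" for w
  proof (rule second_derivative_nonpos_at_max[OF \<delta>(1)])
    fix t :: real assume "\<bar>t\<bar> < \<delta>"
    then have "p + of_real t * w \<in> ball p \<delta>" using that by (simp add: dist_norm norm_mult)
    then have m: "p + of_real t * w \<in> U" using \<delta> by blast
    show "((\<lambda>t. u (p + of_real t * w)) has_real_derivative g (p + of_real t * w) \<bullet> w) (at t)"
      by (rule GDERIV_along_line[OF u[OF m]])
    show "u (p + of_real t * w) \<le> u (p + of_real 0 * w)" using max[OF m] by simp
  next
    have "((\<lambda>t. p + of_real t * w) has_derivative (\<lambda>k. of_real k * w)) (at 0)"
      by (auto intro!: derivative_eq_intros)
    then have "((\<lambda>t. g (p + of_real t * w)) has_derivative (\<lambda>k. H (of_real k * w))) (at 0)"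
      by (rule has_derivative_compose) (use g in simp)
    then have "((\<lambda>t. g (p + of_real t * w) \<bullet> w) has_derivative (\<lambda>k. H (of_real k * w) \<bullet> w)) (at 0)"
      by (rule has_derivative_inner_left)
    moreover have "H (of_real k * w) \<bullet> w = (H w \<bullet> w) * k" for k
      using linear_cmul[OF has_derivative_linear[OF g], of k w] by (simp add: scaleR_conv_of_real[symmetric])
    ultimately show "((\<lambda>t. g (p + of_real t * w) \<bullet> w) has_real_derivative H w \<bullet> w) (at 0)"
      by (simp add: has_field_derivative_def)
  qed
  show ?thesis unfolding trace2_def using *[of 1] *[of \<i>] by simp
qed

text \<open>
  Adding \<open>\<epsilon> * (x \<bullet> x)\<close> makes the Laplacian strictly positive, which excludes interior maxima; then
  \<open>\<epsilon>\<close> tends to zero.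
\<close>
lemma maximum_principle:
  assumes U: "open U" "bounded U" and cont: "continuous_on (closure U) u"
    and bd: "\<And>z. z \<in> frontier U \<Longrightarrow> u z \<le> 0"
    and u: "\<And>z. z \<in> U \<Longrightarrow> GDERIV u z :> g z" 
    and g: "\<And>z. z \<in> U \<Longrightarrow> (g has_derivative H z) (at z)"
    and tr: "\<And>z. z \<in> U \<Longrightarrow> trace2 (H z) \<ge> 0" and z: "z \<in> U"
  shows "u z \<le> 0"
proof -
  have cpt: "compact (closure U)" using U by (simp add: compact_closure)
  obtain M where M: "M > 0" "\<And>x. x \<in> closure U \<Longrightarrow> norm x \<le> M"
    using compact_imp_bounded[OF cpt] bounded_pos by metis
  have le: "u z \<le> \<epsilon> * M\<^sup>2" if \<epsilon>: "\<epsilon> > 0" for \<epsilon>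
  proof -
    have zc: "z \<in> closure U" using z closure_subset by blast
    define W where "W x = u x + \<epsilon> * (x \<bullet> x)" for x
    have cW: "continuous_on (closure U) W" unfolding W_def by (intro continuous_intros cont)
    have "closure U \<noteq> {}" using zc by auto
    from continuous_attains_sup[OF cpt this cW] obtain p where p: "p \<in> closure U" "\<And>x. x \<in> closure U \<Longrightarrow> W x \<le> W p"
      by auto
    have "p \<notin> U"
    proof
      assume pU: "p \<in> U"
      have "trace2 (\<lambda>h. H p h + (2 * \<epsilon>) *\<^sub>R h) \<le> 0"
      proof (rule trace_nonpos_at_max[OF U(1) pU])
        show "GDERIV W x :> g x + (2 * \<epsilon>) *\<^sub>R x" if "x \<in> U" for x
          unfolding W_def gderiv_def
          by (rule derivative_eq_intros refl u[OF that, unfolded gderiv_def])+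
             (simp add: algebra_simps inner_commute)
        show "((\<lambda>x. g x + (2 * \<epsilon>) *\<^sub>R x) has_derivative (\<lambda>h. H p h + (2 * \<epsilon>) *\<^sub>R h)) (at p)"
          by (rule derivative_eq_intros refl g[OF pU])+
        show "W x \<le> W p" if "x \<in> U" for x using p that closure_subset by blast
      qed
      moreover have "trace2 (\<lambda>h. H p h + (2 * \<epsilon>) *\<^sub>R h) = trace2 (H p) + 4 * \<epsilon>"
        by (simp add: trace2_def inner_add_left)
      ultimately show False using tr[OF pU] \<epsilon> by simp
    qed
    then have "p \<in> frontier U" using p(1) U by (simp add: frontier_def interior_open)
    then have "u p \<le> 0" by (rule bd)
    moreover have "p \<bullet> p \<le> M\<^sup>2" 
      using M(2)[OF p(1)] by (metis norm_ge_zero power_mono power2_norm_eq_inner)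
    moreover have "u z \<le> W z" using \<epsilon> by (simp add: W_def)
    ultimately show ?thesis using p(2)[OF zc] \<epsilon> 
      unfolding W_def by (smt (verit) mult_left_mono)
  qed
  show ?thesis
  proof (rule field_le_epsilon)
    fix e :: real assume "e > 0"
    then show "u z \<le> 0 + e" using le[of "e / M\<^sup>2"] M(1) by simp
  qed
qed

lemma harmonic_eq_0:
  assumes U: "open U" "bounded U" and cont: "continuous_on (closure U) u"
    and bd: "\<And>z. z \<in> frontier U \<Longrightarrow> u z = 0"
    and u: "\<And>z. z \<in> U \<Longrightarrow> GDERIV u z :> g z" 
    and g: "\<And>z. z \<in> U \<Longrightarrow> (g has_derivative H z) (at z)"
    and tr: "\<And>z. z \<in> U \<Longrightarrow> trace2 (H z) = 0" and z: "z \<in> U"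
  shows "u z = 0"
proof -
  have "u z \<le> 0"
    by (rule maximum_principle[OF U cont _ u g _ z]) (simp_all add: bd tr)
  moreover have "- u z \<le> 0"
  proof (rule maximum_principle[OF U _ _ _ _ _ z])
    show "continuous_on (closure U) (\<lambda>z. - u z)" by (intro continuous_intros cont)
    show "GDERIV (\<lambda>z. - u z) w :> - g w" if "w \<in> U" for w by (rule GDERIV_minus[OF u[OF that]])
    show "((\<lambda>z. - g z) has_derivative (\<lambda>h. - H w h)) (at w)" if "w \<in> U" for w
      by (rule has_derivative_minus[OF g[OF that]])
    show "0 \<le> trace2 (\<lambda>h. - H w h)" if "w \<in> U" for w
      using tr[OF that] by (simp add: trace2_def)
  qed (simp add: bd)
  ultimately show ?thesis by simp
qed

section \<open>Smooth bump functions\<close>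

text \<open>
  The functions \<open>P t / (1 - t\<^sup>2) ^ m * exp (- 1 / (1 - t\<^sup>2))\<close>, cut off at \<open>\<plusminus>1\<close>, form a family that is closed
  under differentiation. All its members are therefore smooth, including the standard bump function,
  which is the member with \<open>m = 0\<close> and \<open>P = 1\<close>.
\<close>
definition bump_term :: "nat \<Rightarrow> real poly \<Rightarrow> real \<Rightarrow> real" where
  "bump_term m P t = (if \<bar>t\<bar> < 1 then poly P t / (1 - t\<^sup>2) ^ m * exp (- 1 / (1 - t\<^sup>2)) else 0)"

definition bump_term_deriv :: "nat \<Rightarrow> real poly \<Rightarrow> real poly" where
  "bump_term_deriv m P =
     pderiv P * [:1, 0, -1:]\<^sup>2 + smult (2 * real m) ([:0, 1:] * P * [:1, 0, -1:]) - smult 2 ([:0, 1:] * P)"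

lemma exp_neg_inverse_le:
  assumes "s > (0::real)" "n > 0"
  shows "exp (- 1 / s) \<le> (real n * s) ^ n"
proof -
  have "(1 / (real n * s)) ^ n \<le> (1 + (1 / s) / real n) ^ n"
    using assms by (intro power_mono) (auto simp: field_simps)
  also have "\<dots> \<le> exp (1 / s)"
    using assms by (intro exp_ge_one_plus_x_over_n_power_n) (auto intro: order_trans[of _ 0])
  finally have "inverse (exp (1 / s)) \<le> inverse ((1 / (real n * s)) ^ n)"
    using assms by (intro le_imp_inverse_le) auto
  then show ?thesis by (simp add: exp_minus inverse_eq_divide power_one_over)
qed

text \<open>
  Quadratic vanishing of the cut-off function at \<open>\<plusminus>1\<close> is what makes it differentiable there, with
  derivative zero.
\<close>
lemma bump_term_bound:
  obtains C where "C > 0" "\<And>x. \<bar>x\<bar> < 1 \<Longrightarrow> \<bar>bump_term m P x\<bar> \<le> C * (1 - x\<^sup>2)\<^sup>2"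
proof -
  have "bounded (poly P ` {-1..1})"
    by (intro compact_imp_bounded compact_continuous_image continuous_intros) auto
  then obtain M where M: "M > 0" "\<And>x. x \<in> {-1..1} \<Longrightarrow> \<bar>poly P x\<bar> \<le> M"
    unfolding bounded_pos by auto
  show thesis
  proof (rule that[of "M * real (m + 2) ^ (m + 2)"])
    show "M * real (m + 2) ^ (m + 2) > 0" using M by simp
    fix x :: real assume x: "\<bar>x\<bar> < 1"
    define s where "s = 1 - x\<^sup>2"
    have s: "s > 0" using x by (simp add: s_def abs_square_less_1)
    have "\<bar>bump_term m P x\<bar> = \<bar>poly P x\<bar> / s ^ m * exp (- 1 / s)"
      using x s by (simp add: bump_term_def s_def[symmetric] abs_mult)
    also have "\<dots> \<le> M / s ^ m * (real (m + 2) * s) ^ (m + 2)"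
      using M(2)[of x] M(1) x s by (intro mult_mono divide_right_mono exp_neg_inverse_le) (auto simp: abs_less_iff)
    also have "\<dots> = M * real (m + 2) ^ (m + 2) * s\<^sup>2"
    proof -
      have "M / s ^ m * (N * s) ^ (m + 2) = M * N ^ (m + 2) * s\<^sup>2" for N
        using s by (simp add: power_mult_distrib power_add power2_eq_square field_simps)
      then show ?thesis .
    qed
    finally show "\<bar>bump_term m P x\<bar> \<le> M * real (m + 2) ^ (m + 2) * (1 - x\<^sup>2)\<^sup>2"
      by (simp add: s_def)
  qed
qed

lemma has_real_derivative_bump_term:
  "(bump_term m P has_real_derivative bump_term (m + 2) (bump_term_deriv m P) t) (at t)"
proof (cases "\<bar>t\<bar> < 1")
  case True
  define s where "s = 1 - t\<^sup>2"
  have s: "s > 0" using True by (simp add: s_def abs_square_less_1)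
  have "((\<lambda>t. poly P t * inverse (1 - t\<^sup>2) ^ m * exp (- inverse (1 - t\<^sup>2))) has_real_derivative
      bump_term (m + 2) (bump_term_deriv m P) t) (at t)"
  proof -
    have i: "((\<lambda>t. inverse (1 - t\<^sup>2)) has_real_derivative 2 * t * inverse s ^ 2) (at t)"
      using s by (auto intro!: derivative_eq_intros simp: s_def power2_eq_square)
    have p: "((\<lambda>t. inverse (1 - t\<^sup>2) ^ m) has_real_derivative (real m * 2 * t * inverse s ^ (m + 1))) (at t)"
      using DERIV_power[OF i, of m]
      by (cases m) (simp_all add: s_def power2_eq_square algebra_simps)
    have e: "((\<lambda>t. exp (- inverse (1 - t\<^sup>2))) has_real_derivative 
        (- 2 * t * inverse s ^ 2 * exp (- inverse s))) (at t)"
      using DERIV_fun_exp[OF DERIV_minus[OF i]] by (simp add: s_def mult_ac)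
    have "((\<lambda>t. poly P t * inverse (1 - t\<^sup>2) ^ m * exp (- inverse (1 - t\<^sup>2))) has_real_derivative
      (poly (pderiv P) t * inverse s ^ m + poly P t * (real m * 2 * t * inverse s ^ (m + 1))) * exp (- inverse s)
      + poly P t * inverse s ^ m * (- 2 * t * inverse s ^ 2 * exp (- inverse s))) (at t)"
      by (rule derivative_eq_intros poly_DERIV p e refl)+ (simp add: s_def[symmetric] algebra_simps)
    moreover have "(poly (pderiv P) t * inverse s ^ m + poly P t * (real m * 2 * t * inverse s ^ (m + 1))) * exp (- inverse s)
      + poly P t * inverse s ^ m * (- 2 * t * inverse s ^ 2 * exp (- inverse s))
      = bump_term (m + 2) (bump_term_deriv m P) t"
    proof -
      have q: "poly (bump_term_deriv m P) t = 
         poly (pderiv P) t * s\<^sup>2 + 2 * real m * t * poly P t * s - 2 * t * poly P t"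
        by (simp add: bump_term_deriv_def s_def power2_eq_square algebra_simps)
      show ?thesis using True s 
        unfolding bump_term_def q s_def[symmetric]
        by (simp add: inverse_eq_divide power_add power_one_over field_simps power2_eq_square)
    qed
    ultimately show ?thesis by simp
  qed
  then show ?thesis
    by (rule has_field_derivative_transform_within_open[where S = "{-1<..<1}"])
       (use True in \<open>auto simp: bump_term_def inverse_eq_divide power_one_over\<close>)
next
  case False
  obtain C where C: "C > 0" "\<And>x. \<bar>x\<bar> < 1 \<Longrightarrow> \<bar>bump_term m P x\<bar> \<le> C * (1 - x\<^sup>2)\<^sup>2"
    using bump_term_bound by blast
  have bd: "\<bar>bump_term m P (t + h)\<bar> \<le> 4 * C * h\<^sup>2" for h
  proof (cases "\<bar>t + h\<bar> < 1")
    case True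
    have "0 \<le> 1 - (t + h)\<^sup>2" using True by (simp add: abs_square_le_1)
    moreover have "1 - (t + h)\<^sup>2 = (1 - \<bar>t + h\<bar>) * (1 + \<bar>t + h\<bar>)"
      by (simp add: algebra_simps power2_eq_square)
    moreover have "\<dots> \<le> \<bar>h\<bar> * 2" using True False by (intro mult_mono) auto
    ultimately have "(1 - (t + h)\<^sup>2)\<^sup>2 \<le> (\<bar>h\<bar> * 2)\<^sup>2" by (intro power_mono) auto
    then have "C * (1 - (t + h)\<^sup>2)\<^sup>2 \<le> 4 * C * h\<^sup>2" using C(1) by (simp add: power_mult_distrib)
    then show ?thesis using C(2)[OF True] by linarith
  qed (use C in \<open>simp add: bump_term_def\<close>)
  have t0: "bump_term m P t = 0" "bump_term (m + 2) (bump_term_deriv m P) t = 0" 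
    using False by (simp_all add: bump_term_def)
  have "((\<lambda>h. (bump_term m P (t + h) - bump_term m P t) / h) \<longlongrightarrow> 0) (at 0)"
  proof (rule tendsto_0_le[where K = 1])
    show "((\<lambda>h. 4 * C * h) \<longlongrightarrow> 0) (at 0)" by (auto intro!: tendsto_eq_intros)
    show "\<forall>\<^sub>F h in at 0. norm ((bump_term m P (t + h) - bump_term m P t) / h) \<le> norm (4 * C * h) * 1"
    proof (rule eventually_at_filter[THEN iffD2], rule always_eventually, intro allI impI)
      fix h :: real assume "h \<noteq> 0"
      then show "norm ((bump_term m P (t + h) - bump_term m P t) / h) \<le> norm (4 * C * h) * 1"
        using bd[of h] C(1) by (simp add: t0 abs_mult divide_le_eq power2_eq_square mult.assoc)
    qed
  qed
  then show ?thesis by (simp only: DERIV_def t0(2))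
qed

text \<open>
  Products of two one-dimensional bumps, centred at \<open>p\<close> and scaled by \<open>r\<close>. The factor \<open>c\<close> absorbs the
  powers of \<open>1 / r\<close> from the chain rule, so that this family too is closed under partial derivatives.
\<close>
definition bump2 :: "nat \<Rightarrow> real poly \<Rightarrow> nat \<Rightarrow> real poly \<Rightarrow> real \<Rightarrow> real \<Rightarrow> complex \<Rightarrow> complex \<Rightarrow> real" where
  "bump2 m P n Q c r p z = c * bump_term m P (Re (z - p) / r) * bump_term n Q (Im (z - p) / r)"

lemma GDERIV_bump2:
  "GDERIV (bump2 m P n Q c r p) z :> 
     Complex (bump2 (m + 2) (bump_term_deriv m P) n Q (c / r) r p z)
             (bump2 m P (n + 2) (bump_term_deriv n Q) (c / r) r p z)"
proof -
  note d = has_real_derivative_bump_term[unfolded has_field_derivative_def]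
  have 1: "((\<lambda>z. bump_term m P (Re (z - p) / r)) has_derivative
     (\<lambda>h. bump_term (m + 2) (bump_term_deriv m P) (Re (z - p) / r) * (Re h / r))) (at z)" for m P
    unfolding divide_inverse
    by (rule has_derivative_compose[OF _ d]) (auto intro!: derivative_eq_intros)
  have 2: "((\<lambda>z. bump_term m P (Im (z - p) / r)) has_derivative
     (\<lambda>h. bump_term (m + 2) (bump_term_deriv m P) (Im (z - p) / r) * (Im h / r))) (at z)" for m P
    unfolding divide_inverse
    by (rule has_derivative_compose[OF _ d]) (auto intro!: derivative_eq_intros)
  show ?thesis unfolding gderiv_def bump2_def
    by (rule derivative_eq_intros 1 2 refl)+
       (simp add: inner_complex_def fun_eq_iff field_simps)
qed

lemma GDERIV_frechet:
  assumes "GDERIV f z :> g"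
  shows "f differentiable (at z)" "frechet_derivative f (at z) h = h \<bullet> g"
  using assms unfolding gderiv_def
  by (auto simp: differentiable_def frechet_derivative_at[symmetric])

lemma smooth_on_bump2: "smooth_on UNIV (bump2 m P n Q c r p)"
proof -
  have "Ck_on k (bump2 m P n Q c r p) UNIV" for k
  proof (induction k arbitrary: m P n Q c)
    case 0
    have "isCont (bump2 m P n Q c r p) z" for z
      using GDERIV_frechet(1)[OF GDERIV_bump2] differentiable_imp_continuous_within by blast
    then show ?case by (simp add: continuous_at_imp_continuous_on)
  next
    case (Suc k)
    show ?case
      using Suc GDERIV_frechet[OF GDERIV_bump2]
      by (auto simp: Basis_complex_def inner_complex_def)
  qed
  then show ?thesis by (simp add: smooth_on_def)
qed

lemma laplacian_eq_trace2:
  assumes "\<And>z. GDERIV \<phi> z :> g z" "(g has_derivative H) (at z)"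
  shows "laplacian \<phi> z = trace2 H"
proof -
  have "frechet_derivative (\<lambda>z. frechet_derivative \<phi> (at z) b) (at z) b = H b \<bullet> b" for b
  proof -
    have "(\<lambda>z. frechet_derivative \<phi> (at z) b) = (\<lambda>z. g z \<bullet> b)"
      using GDERIV_frechet(2)[OF assms(1)] by (simp add: fun_eq_iff inner_commute)
    moreover have "((\<lambda>z. g z \<bullet> b) has_derivative (\<lambda>h. H h \<bullet> b)) (at z)"
      by (rule has_derivative_inner_left[OF assms(2)])
    ultimately show ?thesis using frechet_derivative_at by metis
  qed
  then show ?thesis by (simp add: laplacian_def trace2_def Basis_complex_def)
qed

lemma has_derivative_Complex:
  assumes "GDERIV a z :> ga" "GDERIV b z :> gb"
  shows "((\<lambda>z. Complex (a z) (b z)) has_derivative (\<lambda>h. Complex (h \<bullet> ga) (h \<bullet> gb))) (at z)"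
proof -
  have eq: "Complex s t = s *\<^sub>R 1 + t *\<^sub>R \<i>" for s t by (simp add: complex_eq_iff)
  show ?thesis unfolding eq
    by (rule derivative_eq_intros assms[unfolded gderiv_def] refl)+
qed

lemma bump_term_eq_0: "\<bar>t\<bar> \<ge> 1 \<Longrightarrow> bump_term m P t = 0"
  by (simp add: bump_term_def)

lemma exists_bump:
  fixes p :: complex
  assumes "r > 0"
  defines "K \<equiv> cbox (p - Complex r r) (p + Complex r r)"
  obtains \<phi> :: "complex \<Rightarrow> real" and \<psi> B where
    "smooth_on UNIV \<phi>" "\<And>z. \<phi> z \<ge> 0" "\<phi> p > 0"
    "\<And>z. GDERIV \<phi> z :> \<psi> z" "\<And>z. (\<psi> has_derivative B z) (at z)"
    "\<And>e. continuous_on UNIV (\<lambda>z. B z e)"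
    "\<And>z. z \<notin> K \<Longrightarrow> \<phi> z = 0" "\<And>z. z \<notin> K \<Longrightarrow> \<psi> z = 0" "\<And>z e. z \<notin> K \<Longrightarrow> B z e = 0"
proof -
  have zero: "bump2 m P n Q c r p z = 0" if "z \<notin> K" for m P n Q c z
  proof -
    have "\<bar>Re (z - p)\<bar> > r \<or> \<bar>Im (z - p)\<bar> > r"
      using that unfolding K_def by (auto simp: in_cbox_complex_iff abs_if split: if_splits)
    then have "\<bar>Re (z - p) / r\<bar> \<ge> 1 \<or> \<bar>Im (z - p) / r\<bar> \<ge> 1"
      using assms(1) by (auto simp: abs_divide)
    then show ?thesis unfolding bump2_def using bump_term_eq_0 by auto
  qed
  have cont: "continuous_on UNIV (bump2 m P n Q c r p)" for m P n Q c
    using smooth_on_bump2[of m P n Q c r p] unfolding smooth_on_def by (metis Ck_on.simps(1))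
  show thesis
    by (rule that[OF smooth_on_bump2[of 0 1 0 1 1 r p] _ _ GDERIV_bump2 has_derivative_Complex[OF GDERIV_bump2 GDERIV_bump2]])
       (use assms(1) in \<open>auto simp: zero complex_eq_iff inner_complex_def intro!: continuous_intros cont\<close>,
        auto simp: bump2_def bump_term_def)
qed

section \<open>From the distributional to the classical Laplacian\<close>

lemma continuous_on_extend_0:
  fixes f :: "'a::euclidean_space \<Rightarrow> real"
  assumes "open U" "compact K" "K \<subseteq> U" "continuous_on U f" "\<And>z. z \<notin> K \<Longrightarrow> f z = 0"
  shows "continuous_on UNIV (\<lambda>z. if z \<in> U then f z else 0)"
proof -
  have "open (- K)" using assms(2) compact_imp_closed by blast
  moreover have "continuous_on U (\<lambda>z. if z \<in> U then f z else 0)"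
    using assms(4) by (simp cong: continuous_on_cong)
  moreover have "continuous_on (- K) (\<lambda>z. if z \<in> U then f z else 0)"
    by (rule continuous_on_eq[OF continuous_on_const[of _ 0]]) (use assms(5) in auto)
  ultimately have "continuous_on (U \<union> - K) (\<lambda>z. if z \<in> U then f z else 0)"
    using assms(1) by (intro continuous_on_open_Un)
  moreover have "U \<union> - K = UNIV" using assms(3) by auto
  ultimately show ?thesis by simp
qed

text \<open>
  Green's second identity. For each direction \<open>e\<close> the field \<open>(g \<bullet> e) * \<phi> - u * (\<psi> \<bullet> e)\<close>, extended by zero
  off \<open>U\<close>, is continuously differentiable with compact support, and in its derivative along \<open>e\<close> the
  terms with first derivatives cancel.
\<close>
lemma green_identity:
  fixes u \<phi> :: "complex \<Rightarrow> real"
  assumes U: "open U" and K: "compact K" "K \<subseteq> U"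
    and u: "\<And>z. z \<in> U \<Longrightarrow> GDERIV u z :> g z" "\<And>z. z \<in> U \<Longrightarrow> (g has_derivative H z) (at z)"
      "\<And>e. continuous_on U (\<lambda>z. H z e)"
    and \<phi>: "\<And>z. GDERIV \<phi> z :> \<psi> z" "\<And>z. (\<psi> has_derivative B z) (at z)"
      "\<And>e. continuous_on UNIV (\<lambda>z. B z e)"
    and z: "\<And>z. z \<notin> K \<Longrightarrow> \<phi> z = 0" "\<And>z. z \<notin> K \<Longrightarrow> \<psi> z = 0" "\<And>z e. z \<notin> K \<Longrightarrow> B z e = 0"
  shows "continuous_on UNIV (\<lambda>z. if z \<in> U then trace2 (H z) * \<phi> z else 0)" (is ?A)
    "continuous_on UNIV (\<lambda>z. if z \<in> U then u z * trace2 (B z) else 0)" (is ?B)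
    "integral\<^sup>L lborel (\<lambda>z. if z \<in> U then trace2 (H z) * \<phi> z else 0)
     = integral\<^sup>L lborel (\<lambda>z. if z \<in> U then u z * trace2 (B z) else 0)" (is ?C)
proof -
  have cu: "continuous_on U u"
    by (intro continuous_at_imp_continuous_on ballI has_derivative_continuous[OF u(1)[unfolded gderiv_def]])
  have c\<phi>: "continuous_on S \<phi>" for S
    by (intro continuous_at_imp_continuous_on ballI has_derivative_continuous[OF \<phi>(1)[unfolded gderiv_def]])
  have cB: "continuous_on S (\<lambda>z. B z e)" for S e
    using \<phi>(3) continuous_on_subset by blast
  have c1: "continuous_on UNIV (\<lambda>z. if z \<in> U then (H z e \<bullet> e) * \<phi> z else 0)" for e
    by (rule continuous_on_extend_0[OF U K]) (auto simp: z intro!: continuous_intros u c\<phi>)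
  have c2: "continuous_on UNIV (\<lambda>z. if z \<in> U then u z * (B z e \<bullet> e) else 0)" for e
    by (rule continuous_on_extend_0[OF U K]) (auto simp: z intro!: continuous_intros cu cB)
  have int1: "integrable lborel (\<lambda>z. if z \<in> U then (H z e \<bullet> e) * \<phi> z else 0)" for e
    by (rule integrable_continuous_compact_support[OF c1 K(1)]) (auto simp: z)
  have int2: "integrable lborel (\<lambda>z. if z \<in> U then u z * (B z e \<bullet> e) else 0)" for e
    by (rule integrable_continuous_compact_support[OF c2 K(1)]) (auto simp: z)
  have e: "integral\<^sup>L lborel (\<lambda>z. if z \<in> U then (H z e \<bullet> e) * \<phi> z else 0)
     = integral\<^sup>L lborel (\<lambda>z. if z \<in> U then u z * (B z e \<bullet> e) else 0)" for e
  proof -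
    define F where "F z = (if z \<in> U then (g z \<bullet> e) * \<phi> z - u z * (\<psi> z \<bullet> e) else 0)" for z
    define F' where "F' z h = (if z \<in> U then (H z h \<bullet> e) * \<phi> z + (g z \<bullet> e) * (h \<bullet> \<psi> z)
        - (h \<bullet> g z) * (\<psi> z \<bullet> e) - u z * (B z h \<bullet> e) else 0)" for z h
    have eq: "F' z e = (if z \<in> U then (H z e \<bullet> e) * \<phi> z else 0) - (if z \<in> U then u z * (B z e \<bullet> e) else 0)" for z
      by (simp add: F'_def inner_commute)
    have "integral\<^sup>L lborel (\<lambda>z. F' z e) = 0"
    proof (rule integral_directional_derivative_eq_0[OF _ _ K(1)])
      show "F z = 0" if "z \<notin> K" for z using that z by (simp add: F_def)
      show "continuous_on UNIV (\<lambda>z. F' z e)" unfolding eq by (intro continuous_intros c1 c2)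
      fix x
      show "(F has_derivative F' x) (at x)"
      proof (cases "x \<in> U")
        case True
        have "((\<lambda>z. (g z \<bullet> e) * \<phi> z - u z * (\<psi> z \<bullet> e)) has_derivative F' x) (at x)"
          unfolding F'_def using True
          by (auto intro!: derivative_eq_intros u(1)[OF True, unfolded gderiv_def] u(2)[OF True]
               \<phi>(1)[unfolded gderiv_def] \<phi>(2) simp: fun_eq_iff)
        then show ?thesis
          by (rule has_derivative_transform_within_open[OF _ U True]) (simp add: F_def)
      next
        case False
        have "open (- K)" using K(1) compact_imp_closed by blast
        then have "(F has_derivative (\<lambda>_. 0)) (at x)"
          by (rule has_derivative_transform_within_open[OF has_derivative_const[of 0]])
             (use False K(2) z in \<open>auto simp: F_def\<close>)
        moreover have "F' x = (\<lambda>_. 0)" using False by (simp add: F'_def fun_eq_iff)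
        ultimately show ?thesis by simp
      qed
    qed
    then show ?thesis unfolding eq using int1 int2 by simp
  qed
  have s1: "(\<lambda>z. if z \<in> U then trace2 (H z) * \<phi> z else 0) = (\<lambda>z. (if z \<in> U then (H z 1 \<bullet> 1) * \<phi> z else 0) + (if z \<in> U then (H z \<i> \<bullet> \<i>) * \<phi> z else 0))"
    by (auto simp: trace2_def distrib_right)
  have s2: "(\<lambda>z. if z \<in> U then u z * trace2 (B z) else 0) = (\<lambda>z. (if z \<in> U then u z * (B z 1 \<bullet> 1) else 0) + (if z \<in> U then u z * (B z \<i> \<bullet> \<i>) else 0))"
    by (auto simp: trace2_def distrib_left)
  show ?A unfolding s1 by (intro continuous_intros c1)
  show ?B unfolding s2 by (intro continuous_intros c2)
  show ?C unfolding s1 s2 Bochner_Integration.integral_add[OF int1 int1] 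
    Bochner_Integration.integral_add[OF int2 int2] e ..
qed

text \<open>
  If the Laplacian \<open>S\<close> of \<open>u\<close> were nonzero at \<open>p\<close>, it would have constant sign on a ball around \<open>p\<close>.
  For a bump \<open>\<phi>\<close> supported in that ball, the distributional equation and Green's identity give
  that the integral of \<open>S * \<phi>\<close> is \<open>\<phi> y = 0\<close>, although the integrand has one sign and does not vanish at \<open>p\<close>.
\<close>
lemma trace_eq_0_of_laplacian_eq_delta:
  assumes delta: "laplacian_eq_delta \<Omega> u y" and U: "open U" "U \<subseteq> \<Omega>" "y \<notin> U"
    and u: "\<And>z. z \<in> U \<Longrightarrow> GDERIV u z :> g z" "\<And>z. z \<in> U \<Longrightarrow> (g has_derivative H z) (at z)"
      "\<And>e. continuous_on U (\<lambda>z. H z e)"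
    and p: "p \<in> U"
  shows "trace2 (H p) = 0"
proof (rule ccontr)
  define S where "S z = trace2 (H z)" for z
  assume "trace2 (H p) \<noteq> 0"
  then have Sp: "S p \<noteq> 0" by (simp add: S_def)
  have cS: "continuous_on U S" unfolding S_def trace2_def by (intro continuous_intros u(3))
  have "open (U \<inter> (\<lambda>z. S p * S z) -` {0<..})"
    by (intro continuous_open_preimage continuous_intros cS U)
  moreover have "p \<in> U \<inter> (\<lambda>z. S p * S z) -` {0<..}" using p Sp by (auto simp: zero_less_mult_iff)
  ultimately obtain \<rho> where \<rho>: "\<rho> > 0" "ball p \<rho> \<subseteq> U \<inter> (\<lambda>z. S p * S z) -` {0<..}"
    unfolding open_contains_ball by blast
  \<comment> \<open>The square with half side \<open>r\<close> has to lie in the ball of radius \<open>\<rho>\<close>, and its points are at distance at most \<open>2 * r\<close>.\<close>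
  define r where "r = \<rho> / 3"
  have r: "r > 0" using \<rho> by (simp add: r_def)
  define a b where "a = p - Complex r r" and "b = p + Complex r r"
  define K where "K = cbox a b"
  have Kball: "K \<subseteq> ball p \<rho>"
  proof
    fix z assume "z \<in> K"
    then have "\<bar>Re (z - p)\<bar> \<le> r \<and> \<bar>Im (z - p)\<bar> \<le> r"
      by (simp add: K_def a_def b_def in_cbox_complex_iff abs_le_iff)
    then have "cmod (z - p) \<le> r + r" using cmod_le[of "z - p"] by linarith
    then show "z \<in> ball p \<rho>" using \<rho>(1) by (simp add: dist_norm norm_minus_commute r_def)
  qed
  then have KU: "compact K" "K \<subseteq> U" using \<rho> by (auto simp: K_def)
  obtain \<phi> \<psi> B where \<phi>: "smooth_on UNIV \<phi>" "\<And>z. \<phi> z \<ge> 0" "\<phi> p > 0"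
    and \<phi>': "\<And>z. GDERIV \<phi> z :> \<psi> z" "\<And>z. (\<psi> has_derivative B z) (at z)"
    "\<And>e. continuous_on UNIV (\<lambda>z. B z e)"
    and zero: "\<And>z. z \<notin> K \<Longrightarrow> \<phi> z = 0" "\<And>z. z \<notin> K \<Longrightarrow> \<psi> z = 0" "\<And>z e. z \<notin> K \<Longrightarrow> B z e = 0"
    apply (rule exists_bump[OF r, of p, folded a_def b_def, folded K_def])
    subgoal for \<phi> \<psi> B by (rule that[of \<phi> \<psi> B]; simp)
    done
  have subK: "{x. \<phi> x \<noteq> 0} \<subseteq> K" using zero(1) by blast
  then have sub: "closure {x. \<phi> x \<noteq> 0} \<subseteq> K" by (intro closure_minimal compact_imp_closed KU(1))
  have "compact (closure {x. \<phi> x \<noteq> 0})"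
    using bounded_subset[OF compact_imp_bounded[OF KU(1)] subK] by simp
  then have "test_function \<Omega> \<phi>" unfolding test_function_def using \<phi>(1) sub KU(2) U(2) by blast
  then have lint: "(LINT x:\<Omega>|lebesgue. u x * laplacian \<phi> x) = \<phi> y"
    using delta unfolding laplacian_eq_delta_def by blast
  have \<phi>y: "\<phi> y = 0" using zero(1) U(3) KU(2) by blast
  note gi = green_identity[OF U(1) KU u \<phi>' zero, folded S_def]
  have "(LINT x:\<Omega>|lebesgue. u x * laplacian \<phi> x) 
      = integral\<^sup>L lebesgue (\<lambda>z. if z \<in> U then u z * trace2 (B z) else 0)"
    unfolding set_lebesgue_integral_def laplacian_eq_trace2[OF \<phi>'(1,2)]
  proof (rule Bochner_Integration.integral_cong[OF refl])
    fix x show "indicat_real \<Omega> x *\<^sub>R (u x * trace2 (B x)) = (if x \<in> U then u x * trace2 (B x) else 0)"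
    proof (cases "x \<in> U")
      case True then show ?thesis using U(2) by auto
    next
      case False
      then have "x \<notin> K" using KU(2) by blast
      then have "trace2 (B x) = 0" by (simp add: trace2_def zero(3))
      then show ?thesis by simp
    qed
  qed
  also have "\<dots> = integral\<^sup>L lborel (\<lambda>z. if z \<in> U then u z * trace2 (B z) else 0)"
    using borel_measurable_continuous_onI[OF gi(2)] by (intro integral_completion) simp
  also have "\<dots> = integral\<^sup>L lborel (\<lambda>z. if z \<in> U then S z * \<phi> z else 0)"
    by (simp add: gi(3))
  finally have int0: "integral\<^sup>L lborel (\<lambda>z. if z \<in> U then S z * \<phi> z else 0) = 0"
    using lint \<phi>y by simp
  \<comment> \<open>The factor \<open>S p\<close> makes the integrand nonnegative whatever the sign of \<open>S\<close>.\<close>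
  define f where "f z = S p * (if z \<in> U then S z * \<phi> z else 0)" for z
  have cf: "continuous_on UNIV f" unfolding f_def by (intro continuous_intros gi(1))
  have f0: "f z = 0" if "z \<notin> K" for z using zero(1)[OF that] by (simp add: f_def)
  have "integrable lborel f" 
    by (rule integrable_continuous_compact_support[OF cf KU(1) f0])
  moreover have "integral\<^sup>L lborel f = 0"
    unfolding f_def integral_mult_right_zero int0 by simp
  ultimately have "(f has_integral 0) UNIV"
    using has_integral_integral_lborel[of f] by simp
  moreover have "(\<lambda>z. if z \<in> K then f z else 0) = f" using f0 by auto
  ultimately have "(f has_integral 0) K"
    using has_integral_restrict_UNIV[of K f 0] by simp
  moreover have "0 \<le> f z" if "z \<in> K" for z
  proof -
    have "0 < S p * S z" "z \<in> U" using that Kball \<rho>(2) by auto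
    then show ?thesis using \<phi>(2)[of z] by (simp add: f_def mult.assoc[symmetric])
  qed
  moreover have p_box: "p \<in> box a b" using r by (simp add: a_def b_def in_box_complex_iff)
  ultimately have "f p = 0"
    unfolding K_def using box_subset_cbox[of a b]
    by (intro has_integral_0_cbox_imp_0[of a b f p] continuous_on_subset[OF cf]) auto
  then show False using Sp \<phi>(3) p by (simp add: f_def)
qed

section \<open>The regular part of the Green's function\<close>

lemma GDERIV_slice:
  fixes f :: "complex \<times> complex \<Rightarrow> real"
  assumes "f differentiable (at (z, y))"
  shows "GDERIV (\<lambda>x. f (x, y)) z :> 
    Complex (frechet_derivative f (at (z, y)) (1, 0)) (frechet_derivative f (at (z, y)) (\<i>, 0))"
proof -
  let ?D = "frechet_derivative f (at (z, y))"
  have D: "(f has_derivative ?D) (at (z, y))" using assms frechet_derivative_works by blast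
  have "((\<lambda>x. (x, y)) has_derivative (\<lambda>h. (h, 0))) (at z)" by (auto intro!: derivative_eq_intros)
  from has_derivative_compose[OF this D]
  have "((\<lambda>x. f (x, y)) has_derivative (\<lambda>h. ?D (h, 0))) (at z)" .
  moreover have "?D (h, 0) = h \<bullet> Complex (?D (1, 0)) (?D (\<i>, 0))" for h
  proof -
    have l: "linear ?D" by (rule has_derivative_linear[OF D])
    have "(h, 0) = Re h *\<^sub>R (1, 0) + Im h *\<^sub>R (\<i>, 0 :: complex)" by (simp add: complex_eq_iff)
    then have "?D (h, 0) = Re h *\<^sub>R ?D (1, 0) + Im h *\<^sub>R ?D (\<i>, 0)"
      by (simp only: linear_add[OF l] linear_cmul[OF l])
    then show ?thesis by (simp add: inner_complex_def)
  qed
  ultimately show ?thesis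
    unfolding gderiv_def by (rule has_derivative_eq_rhs[OF _ ext])
qed

lemma smooth_slice:
  fixes \<gamma> :: "complex \<times> complex \<Rightarrow> real"
  assumes sm: "smooth_on (\<Omega> \<times> \<Omega>) \<gamma>" and y: "y \<in> \<Omega>"
  obtains g H where "\<And>z. z \<in> \<Omega> \<Longrightarrow> GDERIV (\<lambda>x. \<gamma> (x, y)) z :> g z"
    "\<And>z. z \<in> \<Omega> \<Longrightarrow> (g has_derivative H z) (at z)" "\<And>e. continuous_on \<Omega> (\<lambda>z. H z e)"
proof -
  define D where "D b p = frechet_derivative \<gamma> (at p) b" for b p
  define DD where "DD b c p = frechet_derivative (D b) (at p) c" for b c p
  have "Ck_on (Suc (Suc 0)) \<gamma> (\<Omega> \<times> \<Omega>)" using sm by (simp add: smooth_on_def)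
  then have d: "\<And>p. p \<in> \<Omega> \<times> \<Omega> \<Longrightarrow> \<gamma> differentiable (at p)"
    and dd: "\<And>b p. b \<in> Basis \<Longrightarrow> p \<in> \<Omega> \<times> \<Omega> \<Longrightarrow> D b differentiable (at p)"
    and c: "\<And>b c. b \<in> Basis \<Longrightarrow> c \<in> Basis \<Longrightarrow> continuous_on (\<Omega> \<times> \<Omega>) (DD b c)"
    unfolding Ck_on.simps D_def[abs_def] DD_def[abs_def] by blast+
  let ?a = "(1, 0) :: complex \<times> complex" and ?b = "(\<i>, 0) :: complex \<times> complex"
  have B: "?a \<in> Basis" "?b \<in> Basis" by (auto simp: Basis_prod_def Basis_complex_def)
  have cs: "continuous_on \<Omega> (\<lambda>z. DD b c (z, y))" if "b \<in> Basis" "c \<in> Basis" for b c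
    using y by (auto intro!: continuous_on_compose2[OF c[OF that], of \<Omega> "\<lambda>z. (z, y)"] continuous_intros)
  show thesis
  proof (rule that)
    show "GDERIV (\<lambda>x. \<gamma> (x, y)) z :> Complex (D ?a (z, y)) (D ?b (z, y))" if "z \<in> \<Omega>" for z
      unfolding D_def by (rule GDERIV_slice) (use d that y in auto)
    show "((\<lambda>z. Complex (D ?a (z, y)) (D ?b (z, y))) has_derivative 
       (\<lambda>h. Complex (h \<bullet> Complex (DD ?a ?a (z, y)) (DD ?a ?b (z, y))) 
                    (h \<bullet> Complex (DD ?b ?a (z, y)) (DD ?b ?b (z, y))))) (at z)" if "z \<in> \<Omega>" for z
      unfolding DD_def by (intro has_derivative_Complex GDERIV_slice dd B) (use that y in auto)
    show "continuous_on \<Omega> (\<lambda>z. Complex (e \<bullet> Complex (DD ?a ?a (z, y)) (DD ?a ?b (z, y))) 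
                    (e \<bullet> Complex (DD ?b ?a (z, y)) (DD ?b ?b (z, y))))" for e
      by (intro continuous_intros continuous_on_Complex cs B)
  qed
qed

lemma ln_norm_harmonic:
  fixes w :: complex
  assumes "w \<noteq> y"
  shows "GDERIV (\<lambda>x. ln (cmod (x - y))) w :> cnj (1 / (w - y))"
    "((\<lambda>x. cnj (1 / (x - y))) has_derivative (\<lambda>h. cnj (- h / (w - y)\<^sup>2))) (at w)"
    "trace2 (\<lambda>h. cnj (- h / (w - y)\<^sup>2)) = 0"
proof -
  have n: "cmod (w - y) \<noteq> 0" using assms by simp
  have "((\<lambda>x. ln (cmod (x - y))) has_derivative (\<lambda>h. (h \<bullet> sgn (w - y)) / cmod (w - y))) (at w)"
  proof -
    have "((\<lambda>x. x - y) has_derivative (\<lambda>h. h - 0)) (at w)"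
      by (intro has_derivative_diff has_derivative_ident has_derivative_const)
    from has_derivative_compose[OF this has_derivative_norm]
    have "((\<lambda>x. cmod (x - y)) has_derivative (\<lambda>h. h \<bullet> sgn (w - y))) (at w)"
      using assms by simp
    from has_derivative_ln[OF _ this] assms show ?thesis by (simp add: divide_inverse)
  qed
  moreover have "(h \<bullet> sgn (w - y)) / cmod (w - y) = h \<bullet> cnj (1 / (w - y))" for h
  proof -
    have "cnj (1 / (w - y)) = (w - y) /\<^sub>R (cmod (w - y))\<^sup>2"
    proof -
      have "cnj (1 / (w - y)) = (w - y) / ((w - y) * cnj (w - y))" using assms by simp
      also have "\<dots> = (w - y) / of_real ((cmod (w - y))\<^sup>2)" by (simp only: complex_norm_square)
      also have "\<dots> = (w - y) /\<^sub>R (cmod (w - y))\<^sup>2"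
        by (simp add: scaleR_conv_of_real divide_inverse mult.commute)
      finally show ?thesis .
    qed
    then show ?thesis by (simp add: sgn_div_norm power2_eq_square divide_inverse)
  qed
  ultimately show "GDERIV (\<lambda>x. ln (cmod (x - y))) w :> cnj (1 / (w - y))"
    by (simp add: gderiv_def)
  have "((\<lambda>x. 1 / (x - y)) has_field_derivative - 1 / (w - y)\<^sup>2) (at w)"
    using assms by (auto intro!: derivative_eq_intros simp: power2_eq_square)
  then have "((\<lambda>x. 1 / (x - y)) has_derivative (*) (- 1 / (w - y)\<^sup>2)) (at w)"
    by (simp only: has_field_derivative_def)
  from bounded_linear.has_derivative[OF bounded_linear_cnj this]
  have "((\<lambda>x. cnj (1 / (x - y))) has_derivative (\<lambda>h. cnj (- 1 / (w - y)\<^sup>2 * h))) (at w)" .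
  moreover have "cnj (- 1 / (w - y)\<^sup>2 * h) = cnj (- h / (w - y)\<^sup>2)" for h by simp
  ultimately show "((\<lambda>x. cnj (1 / (x - y))) has_derivative (\<lambda>h. cnj (- h / (w - y)\<^sup>2))) (at w)"
    by simp
  define c where "c = cnj (1 / (w - y)\<^sup>2)"
  have "cnj (- 1 / (w - y)\<^sup>2) = - c" "cnj (- \<i> / (w - y)\<^sup>2) = \<i> * c"
    by (simp_all add: c_def)
  then show "trace2 (\<lambda>h. cnj (- h / (w - y)\<^sup>2)) = 0"
    unfolding trace2_def by (simp add: inner_complex_def)
qed

text \<open>
  Off \<open>y\<close> the function \<open>\<gamma> (x, y)\<close> of \<open>x\<close> differs from the Green's function by a multiple of the harmonic function
  \<open>ln (cmod (x - y))\<close>; the Laplacian, being continuous, cannot be nonzero at the single point \<open>y\<close>.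
\<close>
lemma regular_part_harmonic:
  assumes \<Omega>: "open \<Omega>" "y \<in> \<Omega>" and G: "laplacian_eq_delta \<Omega> (\<lambda>x. G x y) y"
    and \<gamma>: "regular_part \<Omega> G \<gamma>"
  obtains g H where "\<And>z. z \<in> \<Omega> \<Longrightarrow> GDERIV (\<lambda>x. \<gamma> (x, y)) z :> g z"
    "\<And>z. z \<in> \<Omega> \<Longrightarrow> (g has_derivative H z) (at z)" "\<And>z. z \<in> \<Omega> \<Longrightarrow> trace2 (H z) = 0"
proof -
  have sm: "smooth_on (\<Omega> \<times> \<Omega>) \<gamma>" using \<gamma> by (simp add: regular_part_def)
  obtain g H where g: "\<And>z. z \<in> \<Omega> \<Longrightarrow> GDERIV (\<lambda>x. \<gamma> (x, y)) z :> g z"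
    "\<And>z. z \<in> \<Omega> \<Longrightarrow> (g has_derivative H z) (at z)" "\<And>e. continuous_on \<Omega> (\<lambda>z. H z e)"
    apply (rule smooth_slice[OF sm \<Omega>(2)])
    subgoal for g H by (rule that[of g H]; simp)
    done
  define U where "U = \<Omega> - {y}"
  have U: "open U" "U \<subseteq> \<Omega>" "y \<notin> U" using \<Omega> by (auto simp: U_def)
  let ?c = "1 / (2 * pi)"
  let ?L = "\<lambda>z h. cnj (- h / (z - y)\<^sup>2)"
  have off: "trace2 (H z) = 0" if z: "z \<in> U" for z
  proof -
    have "trace2 (\<lambda>h. H z h + ?c *\<^sub>R ?L z h) = 0"
    proof (rule trace_eq_0_of_laplacian_eq_delta[OF G U _ _ _ z])
      fix w assume w: "w \<in> U"
      then have wy: "w \<noteq> y" "w \<in> \<Omega>" by (auto simp: U_def)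
      have "((\<lambda>x. \<gamma> (x, y) + ?c * ln (cmod (x - y))) has_derivative 
          (\<lambda>h. h \<bullet> (g w + ?c *\<^sub>R cnj (1 / (w - y))))) (at w)"
        by (rule derivative_eq_intros g(1)[OF wy(2), unfolded gderiv_def] 
             ln_norm_harmonic(1)[OF wy(1), unfolded gderiv_def] refl)+ (simp add: inner_add_right)
      then have "((\<lambda>x. G x y) has_derivative (\<lambda>h. h \<bullet> (g w + ?c *\<^sub>R cnj (1 / (w - y))))) (at w)"
        by (rule has_derivative_transform_within_open[OF _ U(1) w])
           (use \<gamma> \<Omega>(2) in \<open>auto simp: regular_part_def U_def\<close>)
      then show "GDERIV (\<lambda>x. G x y) w :> g w + ?c *\<^sub>R cnj (1 / (w - y))" by (simp only: gderiv_def)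
      show "((\<lambda>w. g w + ?c *\<^sub>R cnj (1 / (w - y))) has_derivative (\<lambda>h. H w h + ?c *\<^sub>R ?L w h)) (at w)"
        by (rule derivative_eq_intros g(2)[OF wy(2)] ln_norm_harmonic(2)[OF wy(1)] refl)+
    next
      show "continuous_on U (\<lambda>z. H z e + ?c *\<^sub>R ?L z e)" for e
        by (intro continuous_intros continuous_on_subset[OF g(3) U(2)]) (auto simp: U_def)
    qed
    moreover have "trace2 (\<lambda>h. H z h + ?c *\<^sub>R ?L z h) = trace2 (H z) + ?c * trace2 (?L z)"
      by (simp only: trace2_def inner_add_left inner_scaleR_left distrib_left)
    ultimately show ?thesis using ln_norm_harmonic(3)[of z y] z by (auto simp: U_def)
  qed
  have "trace2 (H y) = 0"
  proof (rule ccontr)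
    assume n: "trace2 (H y) \<noteq> 0"
    have "continuous_on \<Omega> (\<lambda>z. trace2 (H z))" unfolding trace2_def by (intro continuous_intros g(3))
    \<comment> \<open>The set where the Laplacian is nonzero would be open and reduced to one point.\<close>
    then have "open (\<Omega> \<inter> (\<lambda>z. trace2 (H z)) -` (- {0}))"
      using \<Omega>(1) by (intro continuous_open_preimage) auto
    moreover have "\<Omega> \<inter> (\<lambda>z. trace2 (H z)) -` (- {0}) = {y}"
      using off n \<Omega>(2) by (auto simp: U_def)
    ultimately show False using not_open_singleton[of y] by simp
  qed
  then have "trace2 (H z) = 0" if "z \<in> \<Omega>" for z using off that by (cases "z = y") (auto simp: U_def)
  with g(1,2) show thesis by (rule that)
qed

section \<open>Rotational symmetry and the Robin function\<close>

text \<open>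
  A trace does not depend on the orthonormal basis in which it is computed; this is the rotation
  invariance of the Laplacian.
\<close>
lemma trace2_rotate:
  assumes "linear H" "norm c = 1"
  shows "trace2 (\<lambda>h. cnj c * H (c * h)) = trace2 H"
proof -
  have H: "H z = Re z *\<^sub>R H 1 + Im z *\<^sub>R H \<i>" for z
  proof -
    have "z = Re z *\<^sub>R 1 + Im z *\<^sub>R \<i>" by (simp add: complex_eq_iff)
    then have "H z = H (Re z *\<^sub>R 1 + Im z *\<^sub>R \<i>)" by simp
    then show ?thesis by (simp only: linear_add[OF assms(1)] linear_cmul[OF assms(1)])
  qed
  have c: "(Re c)\<^sup>2 + (Im c)\<^sup>2 = 1" using assms(2) by (simp add: cmod_power2[symmetric])
  have "trace2 (\<lambda>h. cnj c * H (c * h)) = ((Re c)\<^sup>2 + (Im c)\<^sup>2) * trace2 H"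
    unfolding trace2_def H[of "c * 1"] H[of "c * \<i>"]
    by (simp add: inner_complex_def power2_eq_square algebra_simps)
  then show ?thesis using c by simp
qed

lemma rotation_eq: "rotation c \<theta> z = cis \<theta> * z + (c - cis \<theta> * c)"
  by (simp add: rotation_def algebra_simps)

lemma rotation_dist: "cmod (rotation c \<theta> x - rotation c \<theta> y) = cmod (x - y)"
proof -
  have "rotation c \<theta> x - rotation c \<theta> y = cis \<theta> * (x - y)" by (simp add: rotation_def algebra_simps)
  then show ?thesis by (simp add: norm_mult)
qed

lemma rotation_inj: "rotation c \<theta> x = rotation c \<theta> y \<longleftrightarrow> x = y"
  by (simp add: rotation_def)

lemma has_derivative_rotation: "(rotation c \<theta> has_derivative (\<lambda>h. cis \<theta> * h)) (at z within S)"
  unfolding rotation_def[abs_def] by (auto intro!: derivative_eq_intros)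

lemma harmonic_rotate:
  assumes u: "GDERIV u (rotation c \<theta> z) :> g (rotation c \<theta> z)"
    and g: "(g has_derivative H) (at (rotation c \<theta> z))" and tr: "trace2 H = 0"
  shows "GDERIV (\<lambda>z. u (rotation c \<theta> z)) z :> cnj (cis \<theta>) * g (rotation c \<theta> z)"
    "((\<lambda>z. cnj (cis \<theta>) * g (rotation c \<theta> z)) has_derivative (\<lambda>h. cnj (cis \<theta>) * H (cis \<theta> * h))) (at z)"
    "trace2 (\<lambda>h. cnj (cis \<theta>) * H (cis \<theta> * h)) = 0"
proof -
  have "((\<lambda>z. u (rotation c \<theta> z)) has_derivative (\<lambda>h. (cis \<theta> * h) \<bullet> g (rotation c \<theta> z))) (at z)"
    by (rule has_derivative_compose[OF has_derivative_rotation u[unfolded gderiv_def]])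
  moreover have "(cis \<theta> * h) \<bullet> g (rotation c \<theta> z) = h \<bullet> (cnj (cis \<theta>) * g (rotation c \<theta> z))" for h
    by (simp add: inner_complex_def algebra_simps)
  ultimately show "GDERIV (\<lambda>z. u (rotation c \<theta> z)) z :> cnj (cis \<theta>) * g (rotation c \<theta> z)"
    by (simp only: gderiv_def)
  show "((\<lambda>z. cnj (cis \<theta>) * g (rotation c \<theta> z)) has_derivative (\<lambda>h. cnj (cis \<theta>) * H (cis \<theta> * h))) (at z)"
    by (rule has_derivative_mult_right[OF has_derivative_compose[OF has_derivative_rotation g]])
  show "trace2 (\<lambda>h. cnj (cis \<theta>) * H (cis \<theta> * h)) = 0"
    using trace2_rotate[OF has_derivative_linear[OF g], of "cis \<theta>"] tr by simp
qed

text \<open>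
  The difference of the two sides is extended to \<open>closure \<Omega>\<close> by zero. Near \<open>y\<close> its continuity comes
  from \<open>\<gamma>\<close>, elsewhere from that of \<open>G\<close> up to the boundary: the two descriptions overlap on \<open>\<Omega> - {y}\<close>
  because a rotation preserves the distance in the logarithm.
\<close>
lemma regular_part_rotate:
  assumes \<Omega>: "open \<Omega>" "bounded \<Omega>" and R: "rotation c \<theta> ` \<Omega> = \<Omega>"
    and G: "green_function \<Omega> G" and \<gamma>: "regular_part \<Omega> G \<gamma>" and x: "x \<in> \<Omega>" and y: "y \<in> \<Omega>"
  shows "\<gamma> (rotation c \<theta> x, rotation c \<theta> y) = \<gamma> (x, y)"
proof -
  let ?R = "rotation c \<theta>"
  have RI: "?R z \<in> \<Omega>" if "z \<in> \<Omega>" for z using R that by blast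
  have contR: "continuous_on S ?R" for S
    unfolding rotation_def[abs_def] by (intro continuous_intros)
  have Rcl: "?R z \<in> closure \<Omega>" if "z \<in> closure \<Omega>" for z
    using image_closure_subset[OF contR closed_closure, of \<Omega>] R closure_subset that by blast
  have fr: "frontier \<Omega> = closure \<Omega> - \<Omega>" using \<Omega>(1) by (simp add: frontier_def interior_open)
  have Rfr: "?R z \<in> frontier \<Omega>" if "z \<in> frontier \<Omega>" for z
  proof -
    have "?R z \<notin> \<Omega>"
    proof
      assume "?R z \<in> \<Omega>"
      then obtain w where "w \<in> \<Omega>" "?R z = ?R w" using R by (metis imageE)
      then show False using that by (simp add: fr rotation_inj)
    qed
    then show ?thesis using Rcl that by (simp add: fr)
  qed
  have Gc: "continuous_on (closure \<Omega> - {w}) (\<lambda>x. G x w)" and G0: "\<And>z. z \<in> frontier \<Omega> \<Longrightarrow> G z w = 0"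
    and Gd: "laplacian_eq_delta \<Omega> (\<lambda>x. G x w) w" if "w \<in> \<Omega>" for w
    using G that unfolding green_function_def by auto
  obtain g1 H1 where 1: "\<And>z. z \<in> \<Omega> \<Longrightarrow> GDERIV (\<lambda>x. \<gamma> (x, y)) z :> g1 z"
    "\<And>z. z \<in> \<Omega> \<Longrightarrow> (g1 has_derivative H1 z) (at z)" "\<And>z. z \<in> \<Omega> \<Longrightarrow> trace2 (H1 z) = 0"
    apply (rule regular_part_harmonic[OF \<Omega>(1) y Gd[OF y] \<gamma>])
    subgoal for g H by (rule that[of g H]; simp)
    done
  obtain g2 H2 where 2: "\<And>z. z \<in> \<Omega> \<Longrightarrow> GDERIV (\<lambda>x. \<gamma> (x, ?R y)) z :> g2 z"
    "\<And>z. z \<in> \<Omega> \<Longrightarrow> (g2 has_derivative H2 z) (at z)" "\<And>z. z \<in> \<Omega> \<Longrightarrow> trace2 (H2 z) = 0"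
    apply (rule regular_part_harmonic[OF \<Omega>(1) RI[OF y] Gd[OF RI[OF y]] \<gamma>])
    subgoal for g H by (rule that[of g H]; simp)
    done
  note 3 = harmonic_rotate[OF 2[OF RI]]
  define D where "D z = (if z \<in> \<Omega> then \<gamma> (?R z, ?R y) - \<gamma> (z, y) else 0)" for z
  define D' where "D' z = cnj (cis \<theta>) * g2 (?R z) - g1 z" for z
  define D'' where "D'' z h = cnj (cis \<theta>) * H2 (?R z) (cis \<theta> * h) - H1 z h" for z h
  have dD: "GDERIV D z :> D' z" if "z \<in> \<Omega>" for z
  proof -
    have "GDERIV (\<lambda>z. \<gamma> (?R z, ?R y) - \<gamma> (z, y)) z :> D' z"
      unfolding D'_def by (rule GDERIV_diff[OF 3(1) 1(1)]) (rule that)+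
    then show ?thesis unfolding gderiv_def
      by (rule has_derivative_transform_within_open[OF _ \<Omega>(1) that]) (simp add: D_def)
  qed
  have dD': "(D' has_derivative D'' z) (at z)" if "z \<in> \<Omega>" for z
    unfolding D'_def[abs_def] D''_def[abs_def] 
    by (rule has_derivative_diff[OF 3(2) 1(2)]) (rule that)+
  have tr: "trace2 (D'' z) = 0" if "z \<in> \<Omega>" for z
    using 3(3)[OF that that that] 1(3)[OF that] unfolding D''_def[abs_def] trace2_def
    by (simp only: inner_diff_left)
  have "D x = 0"
  proof (rule harmonic_eq_0[OF \<Omega> _ _ dD dD' tr x])
    show "D z = 0" if "z \<in> frontier \<Omega>" for z using that by (simp add: D_def fr)
    have c1: "continuous_on \<Omega> D"
      using dD unfolding gderiv_def
      by (intro continuous_at_imp_continuous_on ballI has_derivative_continuous)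
    have "continuous_on (closure \<Omega> - {y}) (\<lambda>z. G (?R z) (?R y) - G z y)"
      by (intro continuous_intros Gc[OF y] continuous_on_compose2[OF Gc[OF RI[OF y]] contR])
         (auto simp: rotation_inj Rcl)
    moreover have "G (?R z) (?R y) - G z y = D z" if "z \<in> closure \<Omega> - {y}" for z
    proof (cases "z \<in> \<Omega>")
      case True
      then have "\<gamma> (?R z, ?R y) = G (?R z) (?R y) - 1 / (2 * pi) * ln (cmod (?R z - ?R y))"
        "\<gamma> (z, y) = G z y - 1 / (2 * pi) * ln (cmod (z - y))"
        using \<gamma> RI that y unfolding regular_part_def by (auto simp: rotation_inj)
      then show ?thesis using True by (simp add: D_def rotation_dist)
    next
      case False
      then have "z \<in> frontier \<Omega>" using that by (simp add: fr)
      then show ?thesis using G0 Rfr RI y False by (simp add: D_def)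
    qed
    ultimately have c2: "continuous_on (closure \<Omega> - {y}) D" by (rule continuous_on_eq)
    have cl: "closure \<Omega> = \<Omega> \<union> (closure \<Omega> - {y})" using y closure_subset by blast
    have "openin (top_of_set (closure \<Omega>)) \<Omega>" "openin (top_of_set (closure \<Omega>)) (closure \<Omega> - {y})"
      by (rule open_subset[OF closure_subset \<Omega>(1)]) (intro openin_delete, simp)
    then show "continuous_on (closure \<Omega>) D"
      using continuous_on_Un_local_open[of \<Omega> "closure \<Omega> - {y}" D] c1 c2 cl by metis
  qed
  then show ?thesis using x by (simp add: D_def)
qed

text \<open>
  By invariance the differential of the Robin function at the fixed point takes the same value at
  \<open>h\<close> and \<open>cis \<theta> * h\<close>, so it vanishes on all vectors \<open>(cis \<theta> - 1) * h\<close>, that is, on the whole plane.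
\<close>
lemma robin_stationary:
  assumes \<Omega>: "open \<Omega>" "bounded \<Omega>" "x0 \<in> \<Omega>" and R: "rotation x0 \<theta> ` \<Omega> = \<Omega>" and \<theta>: "cis \<theta> \<noteq> 1"
    and G: "green_function \<Omega> G" and \<gamma>: "regular_part \<Omega> G \<gamma>"
  shows "GDERIV (robin \<gamma>) x0 :> 0"
proof -
  have "Ck_on (Suc 0) \<gamma> (\<Omega> \<times> \<Omega>)" using \<gamma> unfolding regular_part_def smooth_on_def by blast
  then have "\<gamma> differentiable (at (x0, x0))" using \<Omega>(3) by simp
  then obtain L where L: "(\<gamma> has_derivative L) (at (x0, x0))" by (auto simp: differentiable_def)
  have "((\<lambda>x. (x, x)) has_derivative (\<lambda>h. (h, h))) (at x0)" by (auto intro!: derivative_eq_intros)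
  from has_derivative_compose[OF this L]
  have r: "(robin \<gamma> has_derivative (\<lambda>h. L (h, h))) (at x0)" by (simp only: robin_def[abs_def])
  have fix0: "rotation x0 \<theta> x0 = x0" by (simp add: rotation_def)
  have "((\<lambda>x. robin \<gamma> (rotation x0 \<theta> x)) has_derivative (\<lambda>h. L (cis \<theta> * h, cis \<theta> * h))) (at x0)"
    by (rule has_derivative_compose[OF has_derivative_rotation]) (simp only: fix0 r)
  then have "(robin \<gamma> has_derivative (\<lambda>h. L (cis \<theta> * h, cis \<theta> * h))) (at x0)"
    by (rule has_derivative_transform_within_open[OF _ \<Omega>(1,3)])
       (simp add: robin_def regular_part_rotate[OF \<Omega>(1,2) R G \<gamma>])
  from has_derivative_unique[OF this r] 
  have eq: "L (cis \<theta> * h, cis \<theta> * h) = L (h, h)" for h by meson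
  have l: "linear (\<lambda>h. L (h, h))" by (rule has_derivative_linear[OF r])
  have "L (k, k) = 0" for k
  proof -
    define h where "h = k / (cis \<theta> - 1)"
    have "k = (cis \<theta> - 1) * h" using \<theta> by (simp add: h_def)
    then have "k = cis \<theta> * h - h" by (simp add: left_diff_distrib)
    then show ?thesis using linear_diff[OF l, of "cis \<theta> * h" h] eq[of h] by simp
  qed
  then show ?thesis using r by (simp add: gderiv_def)
qed

section \<open>Riemann maps of a rotationally symmetric domain\<close>

text \<open>
  The conjugate of the rotation by \<open>T\<close> maps the disk to itself and fixes 0; its derivative there is
  conjugate to, hence equal to, \<open>cis \<theta>\<close>. This has modulus one, the equality case of the Schwarz lemma.
\<close>
lemma biholomorphism_rotate:
  assumes \<Omega>: "open \<Omega>" "x0 \<in> \<Omega>" and R: "rotation x0 \<theta> ` \<Omega> = \<Omega>"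
    and T: "biholomorphism T \<Omega> (ball 0 1)" "T x0 = 0" and z: "z \<in> \<Omega>"
  shows "T (rotation x0 \<theta> z) = cis \<theta> * T z"
proof -
  let ?R = "rotation x0 \<theta>"
  define S where "S = the_inv_into \<Omega> T"
  have bij: "bij_betw T \<Omega> (ball 0 1)" and holT: "T holomorphic_on \<Omega>" and holS: "S holomorphic_on ball 0 1"
    using T(1) by (auto simp: biholomorphism_def S_def)
  have inj: "inj_on T \<Omega>" using bij by (simp add: bij_betw_def)
  have TS: "T (S w) = w" "S w \<in> \<Omega>" if "w \<in> ball 0 1" for w
    using that bij inj unfolding S_def
    by (auto simp: bij_betw_def intro: f_the_inv_into_f the_inv_into_into)
  have ST: "S (T w) = w" "T w \<in> ball 0 1" if "w \<in> \<Omega>" for w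
    using that bij inj unfolding S_def by (auto simp: the_inv_into_f_f dest: bij_betwE)
  have RI: "?R w \<in> \<Omega>" if "w \<in> \<Omega>" for w using R that by blast
  have S0: "S 0 = x0" using ST(1)[OF \<Omega>(2)] T(2) by simp
  have R0: "?R x0 = x0" by (simp add: rotation_def)
  define f where "f w = T (?R (S w))" for w
  have holf: "f holomorphic_on ball 0 1"
  proof -
    have "(\<lambda>w. ?R (S w)) holomorphic_on ball 0 1"
      unfolding rotation_def by (intro holomorphic_intros holS)
    then have "(T \<circ> (\<lambda>w. ?R (S w))) holomorphic_on ball 0 1"
      by (rule holomorphic_on_compose_gen[OF _ holT]) (use TS RI in auto)
    then show ?thesis by (simp add: f_def[abs_def] o_def)
  qed
  have dT: "(T has_field_derivative deriv T x0) (at x0)"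
    by (rule holomorphic_derivI[OF holT \<Omega>])
  have dS: "(S has_field_derivative deriv S 0) (at 0)"
    by (rule holomorphic_derivI[OF holS]) auto
  have "((\<lambda>w. T (S w)) has_field_derivative deriv T x0 * deriv S 0) (at 0)"
    by (rule DERIV_chain2[OF _ dS]) (use dT S0 in simp)
  moreover have "((\<lambda>w. T (S w)) has_field_derivative 1) (at 0)"
    by (rule has_field_derivative_transform_within_open[OF DERIV_ident, of "ball 0 1"]) (use TS in auto)
  ultimately have ts: "deriv T x0 * deriv S 0 = 1" by (rule DERIV_unique)
  have dR: "(?R has_field_derivative cis \<theta>) (at x0)"
    unfolding rotation_def[abs_def] by (auto intro!: derivative_eq_intros)
  have "((\<lambda>w. ?R (S w)) has_field_derivative cis \<theta> * deriv S 0) (at 0)"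
    by (rule DERIV_chain2[OF _ dS]) (use dR S0 in simp)
  then have df: "(f has_field_derivative deriv T x0 * (cis \<theta> * deriv S 0)) (at 0)"
    unfolding f_def[abs_def] by (rule DERIV_chain2[rotated]) (use dT S0 R0 in simp)
  have "deriv T x0 * (cis \<theta> * deriv S 0) = cis \<theta>" using ts by (simp add: mult.left_commute)
  with df have df: "(f has_field_derivative cis \<theta>) (at 0)" by simp
  have f0: "f 0 = 0" by (simp add: f_def S0 R0 T(2))
  have fb: "norm (f w) < 1" if "norm w < 1" for w
    using ST(2)[OF RI[OF TS(2)[of w]]] that by (simp add: f_def)
  have "\<exists>\<alpha>. (\<forall>z. norm z < 1 \<longrightarrow> f z = \<alpha> * z) \<and> norm \<alpha> = 1"
    by (rule Schwarz_Lemma(3)[OF holf f0 fb, of 0]) (simp_all add: DERIV_imp_deriv[OF df])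
  then obtain \<alpha> where \<alpha>: "\<And>z. norm z < 1 \<Longrightarrow> f z = \<alpha> * z" by blast
  have "(f has_field_derivative \<alpha>) (at 0)"
    by (rule has_field_derivative_transform_within_open[OF DERIV_cmult_Id, of "ball 0 1"])
       (use \<alpha> in auto)
  then have "\<alpha> = cis \<theta>" using df by (rule DERIV_unique)
  then show ?thesis using \<alpha>[of "T z"] ST[OF z] by (simp add: f_def)
qed

lemma deriv3_eq_0_of_rotate:
  assumes \<Omega>: "open \<Omega>" "x0 \<in> \<Omega>" and R: "rotation x0 \<theta> ` \<Omega> = \<Omega>" and holT: "T holomorphic_on \<Omega>"
    and eq: "\<And>z. z \<in> \<Omega> \<Longrightarrow> T (rotation x0 \<theta> z) = cis \<theta> * T z" and \<theta>: "cis (2 * \<theta>) \<noteq> 1"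
  shows "(deriv ^^ 3) T x0 = 0"
proof -
  let ?t = "(deriv ^^ 3) T x0"
  have fixpoint: "cis \<theta> * x0 + (x0 - cis \<theta> * x0) = x0" by simp
  have "(deriv ^^ 3) (\<lambda>w. T (cis \<theta> * w + (x0 - cis \<theta> * x0))) x0 
      = cis \<theta> ^ 3 * (deriv ^^ 3) T (cis \<theta> * x0 + (x0 - cis \<theta> * x0))"
    by (rule higher_deriv_compose_linear'[OF holT \<Omega>(1,1,2)])
       (use R in \<open>auto simp: rotation_eq[symmetric]\<close>)
  moreover have "(deriv ^^ 3) (\<lambda>w. T (cis \<theta> * w + (x0 - cis \<theta> * x0))) x0 = (deriv ^^ 3) (\<lambda>w. cis \<theta> * T w) x0"
    by (rule higher_deriv_cong_ev[OF eventually_nhds_in_open[OF \<Omega>, THEN eventually_mono] refl])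
       (simp add: eq[symmetric] rotation_eq)
  moreover have "(deriv ^^ 3) (\<lambda>w. cis \<theta> * T w) x0 = cis \<theta> * ?t"
    by (rule higher_deriv_cmult[OF holT \<Omega>(2,1)])
  ultimately have "cis \<theta> ^ 3 * ?t = cis \<theta> * ?t"
    by (simp only: fixpoint)
  moreover have "cis \<theta> ^ 3 = cis \<theta> * cis (2 * \<theta>)" by (simp add: Complex.DeMoivre cis_mult)
  ultimately have "cis \<theta> * (cis (2 * \<theta>) * ?t) = cis \<theta> * ?t" by (simp only: mult.assoc)
  then show ?thesis using \<theta> by simp
qed

section \<open>Symmetric points\<close>

theorem mainTheorem3:
  fixes \<Omega> :: "complex set" and x0 :: complex and \<theta> :: real
  assumes "open \<Omega>" and "connected \<Omega>" and "bounded \<Omega>" and "simply_connected \<Omega>"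
    and "C11_boundary \<Omega>"
    and "x0 \<in> \<Omega>"
    and "0 < \<theta>" and "\<theta> < 2 * pi"
    and "rotation x0 \<theta> ` \<Omega> = \<Omega>"
  shows "(\<forall>G \<gamma>. green_function \<Omega> G \<and> regular_part \<Omega> G \<gamma> \<longrightarrow> GDERIV (robin \<gamma>) x0 :> 0) \<and>
    (\<theta> \<noteq> pi \<longrightarrow>
      (\<forall>T. biholomorphism T \<Omega> (ball 0 1) \<and> T x0 = 0 \<longrightarrow> (deriv ^^ 3) T x0 = 0))"
proof -
  have cis1: "\<exists>n::int. \<theta>' = of_int n * 2 * pi" if "cis \<theta>' = 1" for \<theta>'
    using that by (simp add: complex_eq_iff cos_one_2pi_int)
  have "cis \<theta> \<noteq> 1"
  proof
    assume "cis \<theta> = 1"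
    then obtain n :: int where n: "\<theta> = of_int n * 2 * pi" using cis1 by blast
    then have "0 < real_of_int n" "real_of_int n < 1"
      using assms(7,8) by (simp_all add: zero_less_mult_iff)
    then show False by simp
  qed
  moreover have "cis (2 * \<theta>) \<noteq> 1" if "\<theta> \<noteq> pi"
  proof
    assume "cis (2 * \<theta>) = 1"
    then obtain n :: int where "2 * \<theta> = of_int n * 2 * pi" using cis1 by blast
    then have n: "\<theta> = of_int n * pi" by simp
    then have "0 < real_of_int n" "real_of_int n < 2"
      using assms(7,8) by (simp_all add: zero_less_mult_iff)
    then have "0 < n" "n < 2" by simp_all
    then have "n = 1" by simp
    then show False using n that by simp
  qed
  ultimately show ?thesis
    using robin_stationary[OF assms(1,3,6,9)] biholomorphism_rotate[OF assms(1,6,9)]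
      deriv3_eq_0_of_rotate[OF assms(1,6,9)] 
    unfolding biholomorphism_def by blast
qed

end
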